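(* Let $K$ be a field, $\lambda\in K$, let $(A,\mu,\alpha_A,\beta_A,R_A)$ be a $\lambda$-Rota-Baxter BiHom-associative algebra, $M$ a vector space, $\alpha_M,\beta_M,R_M:M\to M$ three (pairwise) commuting linear maps and $\triangleright:A\otimes M\to M$, $\triangleleft:M\otimes A\to M$ two linear maps. Define a multiplication on $A\oplus M$ by $$(a+m)\cdot(a'+m')=aa'+a\triangleright m'+m\triangleleft a',\qquad a,a'\in A,\ m,m'\in M.$$ Then $(A\oplus M,\cdot,\alpha_A\oplus\alpha_M,\beta_A\oplus\beta_M,R_A\oplus R_M)$ is a $\lambda$-Rota-Baxter BiHom-associative algebra if and only if $(M,\triangleright,\triangleleft,\alpha_M,\beta_M,R_M)$ is a $\lambda$-Rota-Baxter BiHom-bimodule on $(A,\mu,\alpha_A,\beta_A,R_A)$.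
   Context: $(f\oplus g)(a+m)=f(a)+g(m)$. Everything is over the field $K$. BiHom-associative algebra $(A,\mu,\alpha,\beta)$: linear $\mu$ (written $ab$), $\alpha,\beta:A\to A$ with $\alpha\beta=\beta\alpha$, $\alpha,\beta$ multiplicative, $\alpha(a)(bc)=(ab)\beta(c)$. $\lambda$-Rota-Baxter BiHom-associative algebra $(A,\mu,\alpha,\beta,R)$: BiHom-associative algebra with linear $R$ commuting with $\alpha,\beta$ and $R(a)R(b)=R(aR(b))+R(R(a)b)+\lambda R(ab)$. Bimodule $(M,\triangleright,\triangleleft,\alpha_M,\beta_M)$: $\alpha_M\beta_M=\beta_M\alpha_M$; $f_M(a\triangleright m)=f_A(a)\triangleright f_M(m)$, $f_M(m\triangleleft a)=f_M(m)\triangleleft f_A(a)$ for $f\in\{\alpha,\beta\}$; $\alpha_A(a)\triangleright(a'\triangleright m)=(aa')\triangleright\beta_M(m)$; $\alpha_M(m)\triangleleft(aa')=(m\triangleleft a)\triangleleft\beta_A(a')$; $\alpha_A(a)\triangleright(m\triangleleft a')=(a\triangleright m)\triangleleft\beta_A(a')$. $\lambda$-Rota-Baxter BiHom-bimodule $(M,\triangleright,\triangleleft,\alpha_M,\beta_M,R_M)$: a bimodule with linear $R_M$ commuting with $\alpha_M,\beta_M$ and $R_A(a)\triangleright R_M(m)=R_M(a\triangleright R_M(m)+R_A(a)\triangleright m+\lambda a\triangleright m)$, $R_M(m)\triangleleft R_A(a)=R_M(m\triangleleft R_A(a)+R_M(m)\triangleleft a+\lambda m\triangleleft a)$. *)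

theory Defs
  imports "HOL-Analysis.Product_Vector"
begin

text \<open>
  A \<open>K\<close>-vector space is given by its scalar multiplication, as in \<^locale>\<open>vector_space\<close>.
  A linear map out of a tensor product is represented by the corresponding bilinear map.
\<close>

definition bilinear_map ::
    "('k::field \<Rightarrow> 'a::ab_group_add \<Rightarrow> 'a) \<Rightarrow> ('k \<Rightarrow> 'b::ab_group_add \<Rightarrow> 'b) \<Rightarrow>
     ('k \<Rightarrow> 'c::ab_group_add \<Rightarrow> 'c) \<Rightarrow> ('a \<Rightarrow> 'b \<Rightarrow> 'c) \<Rightarrow> bool"
  where "bilinear_map s1 s2 s3 f \<longleftrightarrow>
    (\<forall>y. Vector_Spaces.linear s1 s3 (\<lambda>x. f x y)) \<and> (\<forall>x. Vector_Spaces.linear s2 s3 (\<lambda>y. f x y))"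

locale bihom_associative_algebra = vector_space scale
  for scale :: "'k::field \<Rightarrow> 'a::ab_group_add \<Rightarrow> 'a" +
  fixes mul :: "'a \<Rightarrow> 'a \<Rightarrow> 'a" (infixl \<open>\<cdot>\<close> 70)
    and \<alpha> \<beta> :: "'a \<Rightarrow> 'a"
  assumes bilinear_mul: "bilinear_map scale scale scale (\<cdot>)"
    and linear_alpha: "Vector_Spaces.linear scale scale \<alpha>"
    and linear_beta: "Vector_Spaces.linear scale scale \<beta>"
    and alpha_beta_commute: "\<alpha> \<circ> \<beta> = \<beta> \<circ> \<alpha>"
    and alpha_mul: "\<alpha> (a \<cdot> b) = \<alpha> a \<cdot> \<alpha> b"
    and beta_mul: "\<beta> (a \<cdot> b) = \<beta> a \<cdot> \<beta> b"
    and bihom_assoc: "\<alpha> a \<cdot> (b \<cdot> c) = (a \<cdot> b) \<cdot> \<beta> c"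

locale rota_baxter_bihom_associative_algebra =
  bihom_associative_algebra scale mul \<alpha> \<beta>
  for scale :: "'k::field \<Rightarrow> 'a::ab_group_add \<Rightarrow> 'a"
    and mul :: "'a \<Rightarrow> 'a \<Rightarrow> 'a" (infixl \<open>\<cdot>\<close> 70)
    and \<alpha> \<beta> :: "'a \<Rightarrow> 'a" +
  fixes R :: "'a \<Rightarrow> 'a" and weight :: 'k
  assumes linear_R: "Vector_Spaces.linear scale scale R"
    and R_alpha_commute: "R \<circ> \<alpha> = \<alpha> \<circ> R"
    and R_beta_commute: "R \<circ> \<beta> = \<beta> \<circ> R"
    and rota_baxter: "R a \<cdot> R b = R (a \<cdot> R b) + R (R a \<cdot> b) + scale weight (R (a \<cdot> b))"

locale bihom_bimodule =
  A: bihom_associative_algebra scale\<^sub>A mul \<alpha>\<^sub>A \<beta>\<^sub>A + M: vector_space scale\<^sub>M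
  for scale\<^sub>A :: "'k::field \<Rightarrow> 'a::ab_group_add \<Rightarrow> 'a"
    and mul :: "'a \<Rightarrow> 'a \<Rightarrow> 'a" (infixl \<open>\<cdot>\<close> 70)
    and \<alpha>\<^sub>A \<beta>\<^sub>A :: "'a \<Rightarrow> 'a"
    and scale\<^sub>M :: "'k \<Rightarrow> 'm::ab_group_add \<Rightarrow> 'm" +
  fixes lact :: "'a \<Rightarrow> 'm \<Rightarrow> 'm" (infixr \<open>\<triangleright>\<close> 70)
    and ract :: "'m \<Rightarrow> 'a \<Rightarrow> 'm" (infixl \<open>\<triangleleft>\<close> 70)
    and \<alpha>\<^sub>M \<beta>\<^sub>M :: "'m \<Rightarrow> 'm"
  assumes bilinear_lact: "bilinear_map scale\<^sub>A scale\<^sub>M scale\<^sub>M (\<triangleright>)"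
    and bilinear_ract: "bilinear_map scale\<^sub>M scale\<^sub>A scale\<^sub>M (\<triangleleft>)"
    and linear_alpha_M: "Vector_Spaces.linear scale\<^sub>M scale\<^sub>M \<alpha>\<^sub>M"
    and linear_beta_M: "Vector_Spaces.linear scale\<^sub>M scale\<^sub>M \<beta>\<^sub>M"
    and alpha_beta_M_commute: "\<alpha>\<^sub>M \<circ> \<beta>\<^sub>M = \<beta>\<^sub>M \<circ> \<alpha>\<^sub>M"
    and alpha_lact: "\<alpha>\<^sub>M (a \<triangleright> m) = \<alpha>\<^sub>A a \<triangleright> \<alpha>\<^sub>M m"
    and beta_lact: "\<beta>\<^sub>M (a \<triangleright> m) = \<beta>\<^sub>A a \<triangleright> \<beta>\<^sub>M m"
    and alpha_ract: "\<alpha>\<^sub>M (m \<triangleleft> a) = \<alpha>\<^sub>M m \<triangleleft> \<alpha>\<^sub>A a"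
    and beta_ract: "\<beta>\<^sub>M (m \<triangleleft> a) = \<beta>\<^sub>M m \<triangleleft> \<beta>\<^sub>A a"
    and lact_assoc: "\<alpha>\<^sub>A a \<triangleright> (a' \<triangleright> m) = (a \<cdot> a') \<triangleright> \<beta>\<^sub>M m"
    and ract_assoc: "\<alpha>\<^sub>M m \<triangleleft> (a \<cdot> a') = (m \<triangleleft> a) \<triangleleft> \<beta>\<^sub>A a'"
    and lact_ract_assoc: "\<alpha>\<^sub>A a \<triangleright> (m \<triangleleft> a') = (a \<triangleright> m) \<triangleleft> \<beta>\<^sub>A a'"

locale rota_baxter_bihom_bimodule =
  A: rota_baxter_bihom_associative_algebra scale\<^sub>A mul \<alpha>\<^sub>A \<beta>\<^sub>A R\<^sub>A weight +
  bihom_bimodule scale\<^sub>A mul \<alpha>\<^sub>A \<beta>\<^sub>A scale\<^sub>M lact ract \<alpha>\<^sub>M \<beta>\<^sub>M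
  for scale\<^sub>A :: "'k::field \<Rightarrow> 'a::ab_group_add \<Rightarrow> 'a"
    and mul :: "'a \<Rightarrow> 'a \<Rightarrow> 'a" (infixl \<open>\<cdot>\<close> 70)
    and \<alpha>\<^sub>A \<beta>\<^sub>A R\<^sub>A :: "'a \<Rightarrow> 'a"
    and weight :: 'k
    and scale\<^sub>M :: "'k \<Rightarrow> 'm::ab_group_add \<Rightarrow> 'm"
    and lact :: "'a \<Rightarrow> 'm \<Rightarrow> 'm" (infixr \<open>\<triangleright>\<close> 70)
    and ract :: "'m \<Rightarrow> 'a \<Rightarrow> 'm" (infixl \<open>\<triangleleft>\<close> 70)
    and \<alpha>\<^sub>M \<beta>\<^sub>M :: "'m \<Rightarrow> 'm" +
  fixes R\<^sub>M :: "'m \<Rightarrow> 'm"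
  assumes linear_R_M: "Vector_Spaces.linear scale\<^sub>M scale\<^sub>M R\<^sub>M"
    and R_alpha_M_commute: "R\<^sub>M \<circ> \<alpha>\<^sub>M = \<alpha>\<^sub>M \<circ> R\<^sub>M"
    and R_beta_M_commute: "R\<^sub>M \<circ> \<beta>\<^sub>M = \<beta>\<^sub>M \<circ> R\<^sub>M"
    and rota_baxter_lact:
      "R\<^sub>A a \<triangleright> R\<^sub>M m = R\<^sub>M ((a \<triangleright> R\<^sub>M m) + (R\<^sub>A a \<triangleright> m) + scale\<^sub>M weight (a \<triangleright> m))"
    and rota_baxter_ract:
      "R\<^sub>M m \<triangleleft> R\<^sub>A a = R\<^sub>M ((m \<triangleleft> R\<^sub>A a) + (R\<^sub>M m \<triangleleft> a) + scale\<^sub>M weight (m \<triangleleft> a))"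

text \<open>
  The direct sum \<open>A \<oplus> M\<close> is the product type, \<open>a + m\<close> being the pair \<open>(a, m)\<close>.  Thus \<open>f \<oplus> g\<close> is
  \<^const>\<open>map_prod\<close> and the scalar multiplication is \<^const>\<open>module_prod.scale\<close>.
\<close>

definition semidirect_mul ::
    "('a \<Rightarrow> 'a \<Rightarrow> 'a) \<Rightarrow> ('a \<Rightarrow> 'm \<Rightarrow> 'm) \<Rightarrow> ('m \<Rightarrow> 'a \<Rightarrow> 'm) \<Rightarrow>
     'a \<times> 'm::ab_group_add \<Rightarrow> 'a \<times> 'm \<Rightarrow> 'a \<times> 'm"
  where "semidirect_mul mul lact ract =
    (\<lambda>(a, m) (a', m'). (mul a a', lact a m' + ract m a'))"

end

theory Submission
  imports Defs
begin

lemma linear_map_prod: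
  assumes "Vector_Spaces.linear s1 t1 f" and "Vector_Spaces.linear s2 t2 g"
  shows "Vector_Spaces.linear (module_prod.scale s1 s2) (module_prod.scale t1 t2) (map_prod f g)"
proof -
  interpret f: Vector_Spaces.linear s1 t1 f by fact
  interpret g: Vector_Spaces.linear s2 t2 g by fact
  interpret s: vector_space_prod s1 s2 ..
  interpret t: vector_space_prod t1 t2 ..
  show ?thesis
    by unfold_locales
      (auto simp: s.scale_def t.scale_def f.add g.add f.scale g.scale)
qed

lemma bilinear_map_simps:
  assumes "bilinear_map s1 s2 s3 f"
  shows "f (x + x') y = f x y + f x' y" and "f x (y + y') = f x y + f x y'"
    and "f (s1 c x) y = s3 c (f x y)" and "f x (s2 c y) = s3 c (f x y)"
    and "f 0 y = 0" and "f x 0 = 0"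
proof -
  interpret l: Vector_Spaces.linear s1 s3 "\<lambda>x. f x y" for y
    using assms by (simp add: bilinear_map_def)
  interpret r: Vector_Spaces.linear s2 s3 "\<lambda>y. f x y" for x
    using assms by (simp add: bilinear_map_def)
  show "f (x + x') y = f x y + f x' y" "f (s1 c x) y = s3 c (f x y)" "f 0 y = 0"
    by (fact l.add l.scale l.zero)+
  show "f x (y + y') = f x y + f x y'" "f x (s2 c y) = s3 c (f x y)" "f x 0 = 0"
    by (fact r.add r.scale r.zero)+
qed

lemma bilinear_semidirect_mul:
  assumes "bilinear_map s s s mul"
    and "bilinear_map s t t lact" and "bilinear_map t s t ract"
  shows "bilinear_map (module_prod.scale s t) (module_prod.scale s t) (module_prod.scale s t)
           (semidirect_mul mul lact ract)"
proof -
  interpret s: vector_space s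
    using assms(1) by (simp add: bilinear_map_def Vector_Spaces.linear_def)
  interpret t: vector_space t
    using assms(2) by (simp add: bilinear_map_def Vector_Spaces.linear_def)
  interpret st: vector_space_prod s t ..
  note simps = assms[THEN bilinear_map_simps(1)] assms[THEN bilinear_map_simps(2)]
    assms[THEN bilinear_map_simps(3)] assms[THEN bilinear_map_simps(4)]
  show ?thesis
    unfolding bilinear_map_def
    by (intro conjI allI; unfold_locales)
      (auto simp: semidirect_mul_def st.scale_def simps t.scale_right_distrib split: prod.splits)
qed

theorem proposition2p22:
  fixes scale\<^sub>A :: "'k::field \<Rightarrow> 'a::ab_group_add \<Rightarrow> 'a"
    and scale\<^sub>M :: "'k \<Rightarrow> 'm::ab_group_add \<Rightarrow> 'm"
    and weight :: 'k
    and mul :: "'a \<Rightarrow> 'a \<Rightarrow> 'a"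
    and \<alpha>\<^sub>A \<beta>\<^sub>A R\<^sub>A :: "'a \<Rightarrow> 'a"
    and \<alpha>\<^sub>M \<beta>\<^sub>M R\<^sub>M :: "'m \<Rightarrow> 'm"
    and lact :: "'a \<Rightarrow> 'm \<Rightarrow> 'm"
    and ract :: "'m \<Rightarrow> 'a \<Rightarrow> 'm"
  assumes "rota_baxter_bihom_associative_algebra scale\<^sub>A mul \<alpha>\<^sub>A \<beta>\<^sub>A R\<^sub>A weight"
    and "vector_space scale\<^sub>M"
    and "Vector_Spaces.linear scale\<^sub>M scale\<^sub>M \<alpha>\<^sub>M"
    and "Vector_Spaces.linear scale\<^sub>M scale\<^sub>M \<beta>\<^sub>M"
    and "Vector_Spaces.linear scale\<^sub>M scale\<^sub>M R\<^sub>M"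
    and "\<alpha>\<^sub>M \<circ> \<beta>\<^sub>M = \<beta>\<^sub>M \<circ> \<alpha>\<^sub>M"
    and "\<alpha>\<^sub>M \<circ> R\<^sub>M = R\<^sub>M \<circ> \<alpha>\<^sub>M"
    and "\<beta>\<^sub>M \<circ> R\<^sub>M = R\<^sub>M \<circ> \<beta>\<^sub>M"
    and "bilinear_map scale\<^sub>A scale\<^sub>M scale\<^sub>M lact"
    and "bilinear_map scale\<^sub>M scale\<^sub>A scale\<^sub>M ract"
  shows "rota_baxter_bihom_associative_algebra
           (module_prod.scale scale\<^sub>A scale\<^sub>M) (semidirect_mul mul lact ract)
           (map_prod \<alpha>\<^sub>A \<alpha>\<^sub>M) (map_prod \<beta>\<^sub>A \<beta>\<^sub>M) (map_prod R\<^sub>A R\<^sub>M) weight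
         \<longleftrightarrow>
         rota_baxter_bihom_bimodule
           scale\<^sub>A mul \<alpha>\<^sub>A \<beta>\<^sub>A R\<^sub>A weight scale\<^sub>M lact ract \<alpha>\<^sub>M \<beta>\<^sub>M R\<^sub>M"
    (is "?algebra \<longleftrightarrow> ?bimodule")
proof -
  interpret A: rota_baxter_bihom_associative_algebra scale\<^sub>A mul \<alpha>\<^sub>A \<beta>\<^sub>A R\<^sub>A weight by fact
  interpret M: vector_space scale\<^sub>M by fact
  interpret AM: vector_space_prod scale\<^sub>A scale\<^sub>M ..
  interpret \<alpha>\<^sub>A: Vector_Spaces.linear scale\<^sub>A scale\<^sub>A \<alpha>\<^sub>A by (fact A.linear_alpha)
  interpret \<beta>\<^sub>A: Vector_Spaces.linear scale\<^sub>A scale\<^sub>A \<beta>\<^sub>A by (fact A.linear_beta)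
  interpret R\<^sub>A: Vector_Spaces.linear scale\<^sub>A scale\<^sub>A R\<^sub>A by (fact A.linear_R)
  interpret \<alpha>\<^sub>M: Vector_Spaces.linear scale\<^sub>M scale\<^sub>M \<alpha>\<^sub>M by fact
  interpret \<beta>\<^sub>M: Vector_Spaces.linear scale\<^sub>M scale\<^sub>M \<beta>\<^sub>M by fact
  interpret R\<^sub>M: Vector_Spaces.linear scale\<^sub>M scale\<^sub>M R\<^sub>M by fact
  note bilinear = A.bilinear_mul assms(9,10)
  note additive =
    \<alpha>\<^sub>M.add \<beta>\<^sub>M.add R\<^sub>M.add R\<^sub>M.scale M.scale_right_distrib
    bilinear[THEN bilinear_map_simps(1)] bilinear[THEN bilinear_map_simps(2)]
  note zero = \<alpha>\<^sub>A.zero \<beta>\<^sub>A.zero R\<^sub>A.zero \<alpha>\<^sub>M.zero \<beta>\<^sub>M.zero R\<^sub>M.zero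
    bilinear[THEN bilinear_map_simps(5)] bilinear[THEN bilinear_map_simps(6)]
  show ?thesis
  proof
    assume ?algebra
    then interpret P: rota_baxter_bihom_associative_algebra
      "AM.scale" "semidirect_mul mul lact ract"
      "map_prod \<alpha>\<^sub>A \<alpha>\<^sub>M" "map_prod \<beta>\<^sub>A \<beta>\<^sub>M" "map_prod R\<^sub>A R\<^sub>M" weight .
    note simps = semidirect_mul_def AM.scale_def zero
    show ?bimodule
    proof unfold_locales
      fix a a' m
      show "\<alpha>\<^sub>M (lact a m) = lact (\<alpha>\<^sub>A a) (\<alpha>\<^sub>M m)"
        using P.alpha_mul[of "(a, 0)" "(0, m)"] by (simp add: simps)
      show "\<beta>\<^sub>M (lact a m) = lact (\<beta>\<^sub>A a) (\<beta>\<^sub>M m)"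
        using P.beta_mul[of "(a, 0)" "(0, m)"] by (simp add: simps)
      show "\<alpha>\<^sub>M (ract m a) = ract (\<alpha>\<^sub>M m) (\<alpha>\<^sub>A a)"
        using P.alpha_mul[of "(0, m)" "(a, 0)"] by (simp add: simps)
      show "\<beta>\<^sub>M (ract m a) = ract (\<beta>\<^sub>M m) (\<beta>\<^sub>A a)"
        using P.beta_mul[of "(0, m)" "(a, 0)"] by (simp add: simps)
      show "lact (\<alpha>\<^sub>A a) (lact a' m) = lact (mul a a') (\<beta>\<^sub>M m)"
        using P.bihom_assoc[of "(a, 0)" "(a', 0)" "(0, m)"] by (simp add: simps)
      show "ract (\<alpha>\<^sub>M m) (mul a a') = ract (ract m a) (\<beta>\<^sub>A a')"
        using P.bihom_assoc[of "(0, m)" "(a, 0)" "(a', 0)"] by (simp add: simps)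
      show "lact (\<alpha>\<^sub>A a) (ract m a') = ract (lact a m) (\<beta>\<^sub>A a')"
        using P.bihom_assoc[of "(a, 0)" "(0, m)" "(a', 0)"] by (simp add: simps)
      show "lact (R\<^sub>A a) (R\<^sub>M m) =
          R\<^sub>M (lact a (R\<^sub>M m) + lact (R\<^sub>A a) m + scale\<^sub>M weight (lact a m))"
        using P.rota_baxter[of "(a, 0)" "(0, m)"] by (simp add: simps additive)
      show "ract (R\<^sub>M m) (R\<^sub>A a) =
          R\<^sub>M (ract m (R\<^sub>A a) + ract (R\<^sub>M m) a + scale\<^sub>M weight (ract m a))"
        using P.rota_baxter[of "(0, m)" "(a, 0)"] by (simp add: simps additive)
    qed (use assms in simp_all)
  next
    assume ?bimodule
    then interpret B: rota_baxter_bihom_bimodule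
      scale\<^sub>A mul \<alpha>\<^sub>A \<beta>\<^sub>A R\<^sub>A weight scale\<^sub>M lact ract \<alpha>\<^sub>M \<beta>\<^sub>M R\<^sub>M .
    show ?algebra
    proof (intro rota_baxter_bihom_associative_algebra.intro bihom_associative_algebra.intro
        rota_baxter_bihom_associative_algebra_axioms.intro bihom_associative_algebra_axioms.intro)
      show "vector_space AM.scale" ..
      show "bilinear_map AM.scale AM.scale AM.scale (semidirect_mul mul lact ract)"
        by (intro bilinear_semidirect_mul bilinear)
      show "Vector_Spaces.linear AM.scale AM.scale (map_prod \<alpha>\<^sub>A \<alpha>\<^sub>M)"
        "Vector_Spaces.linear AM.scale AM.scale (map_prod \<beta>\<^sub>A \<beta>\<^sub>M)"
        "Vector_Spaces.linear AM.scale AM.scale (map_prod R\<^sub>A R\<^sub>M)"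
        using A.linear_alpha A.linear_beta A.linear_R assms(3-5) by (auto intro: linear_map_prod)
      show "map_prod \<alpha>\<^sub>A \<alpha>\<^sub>M \<circ> map_prod \<beta>\<^sub>A \<beta>\<^sub>M = map_prod \<beta>\<^sub>A \<beta>\<^sub>M \<circ> map_prod \<alpha>\<^sub>A \<alpha>\<^sub>M"
        "map_prod R\<^sub>A R\<^sub>M \<circ> map_prod \<alpha>\<^sub>A \<alpha>\<^sub>M = map_prod \<alpha>\<^sub>A \<alpha>\<^sub>M \<circ> map_prod R\<^sub>A R\<^sub>M"
        "map_prod R\<^sub>A R\<^sub>M \<circ> map_prod \<beta>\<^sub>A \<beta>\<^sub>M = map_prod \<beta>\<^sub>A \<beta>\<^sub>M \<circ> map_prod R\<^sub>A R\<^sub>M"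
        by (simp_all add: map_prod.comp A.alpha_beta_commute A.R_alpha_commute A.R_beta_commute
            B.alpha_beta_M_commute B.R_alpha_M_commute B.R_beta_M_commute)
      fix x y z :: "'a \<times> 'm"
      obtain a m b n c p where xyz: "x = (a, m)" "y = (b, n)" "z = (c, p)"
        by (meson surj_pair)
      note simps = xyz semidirect_mul_def AM.scale_def additive
      show "map_prod \<alpha>\<^sub>A \<alpha>\<^sub>M (semidirect_mul mul lact ract x y) =
          semidirect_mul mul lact ract (map_prod \<alpha>\<^sub>A \<alpha>\<^sub>M x) (map_prod \<alpha>\<^sub>A \<alpha>\<^sub>M y)"
        by (simp add: simps A.alpha_mul B.alpha_lact B.alpha_ract)
      show "map_prod \<beta>\<^sub>A \<beta>\<^sub>M (semidirect_mul mul lact ract x y) =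
          semidirect_mul mul lact ract (map_prod \<beta>\<^sub>A \<beta>\<^sub>M x) (map_prod \<beta>\<^sub>A \<beta>\<^sub>M y)"
        by (simp add: simps A.beta_mul B.beta_lact B.beta_ract)
      show "semidirect_mul mul lact ract (map_prod \<alpha>\<^sub>A \<alpha>\<^sub>M x) (semidirect_mul mul lact ract y z) =
          semidirect_mul mul lact ract (semidirect_mul mul lact ract x y) (map_prod \<beta>\<^sub>A \<beta>\<^sub>M z)"
        by (simp add: simps A.bihom_assoc B.lact_assoc B.ract_assoc B.lact_ract_assoc ac_simps)
      show "semidirect_mul mul lact ract (map_prod R\<^sub>A R\<^sub>M x) (map_prod R\<^sub>A R\<^sub>M y) =
          map_prod R\<^sub>A R\<^sub>M (semidirect_mul mul lact ract x (map_prod R\<^sub>A R\<^sub>M y)) +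
          map_prod R\<^sub>A R\<^sub>M (semidirect_mul mul lact ract (map_prod R\<^sub>A R\<^sub>M x) y) +
          AM.scale weight (map_prod R\<^sub>A R\<^sub>M (semidirect_mul mul lact ract x y))"
        by (simp add: simps A.rota_baxter B.rota_baxter_lact B.rota_baxter_ract ac_simps)
    qed
  qed
qed

end
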